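(* Let $(X,d)$ be a finite metric space with $|X|\ge 2$. Then the spectral gap (second smallest eigenvalue, counted with multiplicity) of the normalized distance Laplacian $\mathcal D^{\mathcal L}(X,d)$ is at least $\frac{9-4\sqrt2}{7}$.
   Context: For a finite metric space $(X,d)$, the distance matrix $\mathcal D=\mathcal D(X,d)$ is indexed by $X$ with entries $\mathcal D_{uv}=d(u,v)$; the transmission is $t(u)=\sum_{v\in X}d(u,v)$; the transmission matrix is $T=\operatorname{diag}(t(u):u\in X)$; and the normalized distance Laplacian is $\mathcal D^{\mathcal L}(X,d)=T^{-1/2}(T-\mathcal D)T^{-1/2}$. It is a real symmetric matrix whose smallest eigenvalue is $0$; its spectral gap is its second smallest eigenvalue, counted with multiplicity. *)

theory Defs
  imports "HOL-Analysis.Analysis" "HOL-Library.Multiset"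
begin

text \<open>
  The points of a finite metric space are the elements of a finite type \<open>'a\<close>, with metric \<open>d\<close>
  satisfying \<open>Metric_space UNIV d\<close>; the matrices below are therefore indexed by the points themselves.
\<close>

definition diag_matrix :: "('a \<Rightarrow> real) \<Rightarrow> real ^ 'a ^ 'a::finite" where
  "diag_matrix f = (\<chi> u v. if u = v then f u else 0)"

definition distance_matrix :: "('a \<Rightarrow> 'a \<Rightarrow> real) \<Rightarrow> real ^ 'a ^ 'a::finite" where
  "distance_matrix d = (\<chi> u v. d u v)"

definition transmission :: "('a::finite \<Rightarrow> 'a \<Rightarrow> real) \<Rightarrow> 'a \<Rightarrow> real" where
  "transmission d u = (\<Sum>v\<in>UNIV. d u v)"

definition transmission_matrix :: "('a \<Rightarrow> 'a \<Rightarrow> real) \<Rightarrow> real ^ 'a ^ 'a::finite" where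
  "transmission_matrix d = diag_matrix (transmission d)"

text \<open>
  The outer factors are \<open>T\<^sup>-\<^sup>1\<^sup>/\<^sup>2\<close> for the transmission matrix \<open>T\<close>: in a metric space with at least two
  points all transmissions are positive, so the real power is taken of a positive base.
\<close>

definition normalized_distance_laplacian ::
    "('a \<Rightarrow> 'a \<Rightarrow> real) \<Rightarrow> real ^ 'a ^ 'a::finite" where
  "normalized_distance_laplacian d =
     diag_matrix (\<lambda>u. transmission d u powr (-1/2))
       ** (transmission_matrix d - distance_matrix d)
       ** diag_matrix (\<lambda>u. transmission d u powr (-1/2))"

definition eigenspace :: "real ^ 'a ^ 'a::finite \<Rightarrow> real \<Rightarrow> (real ^ 'a) set" where
  "eigenspace A l = {v. A *v v = l *\<^sub>R v}"

definition eigenvalues :: "real ^ 'a ^ 'a::finite \<Rightarrow> real set" where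
  "eigenvalues A = {l. \<exists>v. v \<noteq> 0 \<and> A *v v = l *\<^sub>R v}"

text \<open>
  Multiplicities are dimensions of eigenspaces. For real symmetric matrices, the only ones considered
  here, they agree with the algebraic multiplicities and add up to the size of the matrix.
\<close>

definition eigenvalue_mset :: "real ^ 'a ^ 'a::finite \<Rightarrow> real multiset" where
  "eigenvalue_mset A = (\<Sum>l\<in>eigenvalues A. replicate_mset (dim (eigenspace A l)) l)"

text \<open>
  The second smallest eigenvalue with multiplicity. Lists are indexed from \<open>0\<close>; the entry exists for
  every symmetric matrix of size at least two.
\<close>

definition spectral_gap :: "real ^ 'a ^ 'a::finite \<Rightarrow> real" where
  "spectral_gap A = sorted_list_of_multiset (eigenvalue_mset A) ! 1"

end

theory Submission
  imports Defs
begin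

text \<open>
  For \<open>f\<close> with \<open>\<Sum>f = 0\<close>, let \<open>p\<close> and \<open>q\<close> be its positive and negative parts, which have equal sums.
  Averaging the triangle inequality \<open>d u v \<le> d u w + d w v\<close> over \<open>w\<close> with weights \<open>q w\<close> gives
  \<open>\<langle>p, D p\<rangle> \<le> 2\<langle>p, D q\<rangle>\<close>, and likewise \<open>\<langle>q, D q\<rangle> \<le> 2\<langle>p, D q\<rangle>\<close>. Hence
  \<open>3\<langle>f, D f\<rangle> \<le> \<langle>\<bar>f\<bar>, D \<bar>f\<bar>\<rangle> \<le> \<langle>f, T f\<rangle>\<close>. In terms of \<open>T\<^sup>1\<^sup>/\<^sup>2 f\<close> this says that the quadratic form
  of the normalized distance Laplacian is at least \<open>2/3\<close> on a hyperplane. Since the kernel vector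
  \<open>T\<^sup>1\<^sup>/\<^sup>2 1\<close> lies outside this hyperplane, every eigenvector orthogonal to it has eigenvalue at least
  \<open>2/3\<close>, which exceeds the claimed bound.
\<close>

section \<open>Eigenvectors of symmetric matrices\<close>

lemma inner_matrix_vector_mult_symmetric:
  fixes A :: "real ^ 'n ^ 'n"
  assumes "transpose A = A"
  shows "x \<bullet> (A *v y) = (A *v x) \<bullet> y"
  by (metis assms dot_lmul_matrix transpose_matrix_vector)

text \<open>Rayleigh's principle: a maximizer \<open>v\<close> of the quadratic form on the unit
  sphere of \<open>V\<close> is an eigenvector. Invariance puts the residual \<open>g\<close> in
  \<open>V\<close>, so \<open>v\<close> may be varied along \<open>g\<close>, and maximality forces
  \<open>g = 0\<close>.\<close>

lemma symmetric_eigenvector_in_invariant_subspace: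
  fixes A :: "real ^ 'n ^ 'n"
  assumes sym: "transpose A = A" and V: "subspace V" "V \<noteq> {0}"
    and inv: "\<And>x. x \<in> V \<Longrightarrow> A *v x \<in> V"
  obtains v l where "v \<in> V" "v \<noteq> 0" "A *v v = l *\<^sub>R v"
proof -
  let ?S = "V \<inter> sphere 0 1"
  obtain x where x: "x \<in> V" "x \<noteq> 0"
    using V subspace_0 by blast
  have "x /\<^sub>R norm x \<in> ?S"
    using x V(1) by (simp add: subspace_scale)
  then have ne: "?S \<noteq> {}" by blast
  have comp: "compact ?S"
    by (simp add: V(1) closed_subspace closed_Int_compact)
  have "continuous_on ?S (\<lambda>y. y \<bullet> (A *v y))"
    by (intro continuous_intros matrix_vector_mult_linear_continuous_on)
  then obtain v where v: "v \<in> ?S" and max: "\<And>y. y \<in> ?S \<Longrightarrow> y \<bullet> (A *v y) \<le> v \<bullet> (A *v v)"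
    using continuous_attains_sup[OF comp ne] by blast
  define l where "l = v \<bullet> (A *v v)"
  have vv: "v \<bullet> v = 1" and vV: "v \<in> V"
    using v by (auto simp: dot_square_norm)
  have bound: "y \<bullet> (A *v y) \<le> l * (y \<bullet> y)" if y: "y \<in> V" for y
  proof (cases "y = 0")
    case False
    have "y /\<^sub>R norm y \<in> ?S"
      using y False V(1) by (simp add: subspace_scale)
    from max[OF this] have "(y \<bullet> (A *v y)) / (norm y)^2 \<le> l"
      by (simp add: l_def matrix_vector_mult_scaleR power2_eq_square divide_inverse mult_ac)
    then show ?thesis
      using False by (simp add: divide_le_eq dot_square_norm)
  qed simp
  define g where "g = A *v v - l *\<^sub>R v"
  have gV: "g \<in> V"
    unfolding g_def using inv vV V(1) by (simp add: subspace_diff subspace_scale)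
  define K where "K = l * (g \<bullet> g) - g \<bullet> (A *v g)"
  \<comment> \<open>In \<open>bound\<close> at \<open>v + s *\<^sub>R g\<close> the constant terms
    and the terms in \<open>g \<bullet> v\<close> cancel, leaving a term linear in \<open>s\<close>
    against a quadratic one.\<close>
  have key: "2 * s * (g \<bullet> g) \<le> s^2 * K" for s
  proof -
    have "v + s *\<^sub>R g \<in> V"
      using vV gV V(1) by (simp add: subspace_add subspace_scale)
    from bound[OF this]
    have "v \<bullet> (A *v v) + 2 * s * (g \<bullet> (A *v v)) + s^2 * (g \<bullet> (A *v g))
          \<le> l * (v \<bullet> v + 2 * s * (g \<bullet> v) + s^2 * (g \<bullet> g))"
      using inner_matrix_vector_mult_symmetric[OF sym, of v g]
      by (simp add: matrix_vector_right_distrib matrix_vector_mult_scaleR inner_add_left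
          inner_add_right inner_commute power2_eq_square algebra_simps)
    moreover have Av: "g \<bullet> (A *v v) = g \<bullet> g + l * (g \<bullet> v)"
      using inner_diff_right[of g "A *v v" "l *\<^sub>R v", folded g_def] by simp
    ultimately show ?thesis
      unfolding K_def vv Av l_def[symmetric] by (simp add: algebra_simps)
  qed
  have "g \<bullet> g \<le> 0"
  proof (rule ccontr)
    assume "\<not> g \<bullet> g \<le> 0"
    then have pos: "g \<bullet> g > 0" by (simp only: not_le)
    \<comment> \<open>Small enough that the linear term of \<open>key\<close> wins:
      \<open>s * (\<bar>K\<bar> + 1)\<close> is exactly \<open>g \<bullet> g\<close>. The summand 1
      covers \<open>K = 0\<close>.\<close>
    define s where "s = (g \<bullet> g) / (\<bar>K\<bar> + 1)"
    have s: "s > 0" using pos by (simp add: s_def)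
    have "2 * (g \<bullet> g) \<le> s * K"
      using key[of s] s by (simp add: power2_eq_square)
    also have "\<dots> \<le> s * (\<bar>K\<bar> + 1)"
      using s by (intro mult_left_mono) auto
    also have "\<dots> = g \<bullet> g"
      by (simp add: s_def)
    finally show False using pos by simp
  qed
  then have "g = 0" by (metis inner_gt_zero_iff not_less)
  moreover have "v \<noteq> 0"
    using vv by (metis inner_zero_left zero_neq_one)
  ultimately show ?thesis
    using that[of v l] vV by (simp add: g_def)
qed

text \<open>Eigenvectors of distinct eigenvalues are orthogonal, hence independent. Finiteness
  matters because a sum over an infinite index set defaults to the empty multiset.\<close>

lemma finite_eigenvalues_symmetric:
  fixes A :: "real ^ 'n ^ 'n"
  assumes sym: "transpose A = A"
  shows "finite (eigenvalues A)"
proof -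
  obtain e where e: "\<And>l. l \<in> eigenvalues A \<Longrightarrow> e l \<noteq> 0 \<and> A *v e l = l *\<^sub>R e l"
    using bchoice[of "eigenvalues A" "\<lambda>l v. v \<noteq> 0 \<and> A *v v = l *\<^sub>R v"]
    by (auto simp: eigenvalues_def)
  have orth: "e l \<bullet> e m = 0" if "l \<in> eigenvalues A" "m \<in> eigenvalues A" "l \<noteq> m" for l m
  proof -
    have "l * (e l \<bullet> e m) = m * (e l \<bullet> e m)"
      using inner_matrix_vector_mult_symmetric[OF sym, of "e l" "e m"] that e by simp
    then show ?thesis using that(3) by simp
  qed
  have "inj_on e (eigenvalues A)"
    by (rule inj_onI) (metis e orth inner_eq_zero_iff)
  moreover have "independent (e ` eigenvalues A)"
    by (rule pairwise_orthogonal_independent)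
      (use e orth in \<open>auto simp: pairwise_def orthogonal_def\<close>)
  ultimately show ?thesis
    using independent_bound finite_imageD by blast
qed

lemma nth_1_sorted_list_of_multiset_ge:
  fixes a :: "'b::linorder"
  assumes "R \<noteq> {#}" "\<And>x. x \<in># R \<Longrightarrow> b \<le> x" "a \<le> b"
  shows "b \<le> sorted_list_of_multiset (add_mset a R) ! 1"
proof -
  define xs where "xs = sorted_list_of_multiset R"
  have set: "set xs = set_mset R" by (simp add: xs_def)
  have "sorted_list_of_multiset (add_mset a R) = a # xs"
    using assms set unfolding xs_def
    by (subst sorted_list_of_multiset_insert) (auto intro!: insort_is_Cons order_trans[of a b])
  moreover have "xs ! 0 \<in> set xs"
    using assms(1) set by (intro nth_mem) auto
  ultimately show ?thesis
    using assms(2) set by auto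
qed

text \<open>The hypothesis on eigenvectors orthogonal to \<open>w\<close> makes \<open>a\<close> a
  simple eigenvalue, and by symmetry it applies to the eigenvectors of every other eigenvalue. So
  \<open>a\<close> is entry 0 of the sorted list and all later entries are at least
  \<open>b\<close>.\<close>

lemma spectral_gap_ge:
  fixes A :: "real ^ 'n ^ 'n"
  assumes sym: "transpose A = A" and card: "CARD('n) \<ge> 2"
    and w: "w \<noteq> 0" "A *v w = a *\<^sub>R w" and "a < b"
    and ge: "\<And>v l. v \<noteq> 0 \<Longrightarrow> v \<bullet> w = 0 \<Longrightarrow> A *v v = l *\<^sub>R v \<Longrightarrow> b \<le> l"
  shows "spectral_gap A \<ge> b"
proof -
  have fin: "finite (eigenvalues A)"
    by (rule finite_eigenvalues_symmetric[OF sym])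
  have aw: "a \<in> eigenvalues A"
    using w by (auto simp: eigenvalues_def)
  have "eigenspace A a = span {w}"
  proof (intro equalityI subsetI)
    fix v assume "v \<in> eigenspace A a"
    then have v: "A *v v = a *\<^sub>R v" by (simp add: eigenspace_def)
    \<comment> \<open>Projection coefficient onto \<open>w\<close>: a nonzero remainder would be an
      eigenvector for \<open>a < b\<close> orthogonal to \<open>w\<close>, against
      \<open>ge\<close>.\<close>
    define c where "c = (v \<bullet> w) / (w \<bullet> w)"
    have "A *v (v - c *\<^sub>R w) = a *\<^sub>R (v - c *\<^sub>R w)"
      using v w(2) by (simp add: matrix_vector_mult_diff_distrib matrix_vector_mult_scaleR
          scaleR_diff_right scaleR_left_commute)
    moreover have "(v - c *\<^sub>R w) \<bullet> w = 0"
      using w(1) by (simp add: inner_diff_left c_def)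
    ultimately have "v - c *\<^sub>R w = 0"
      using ge[of "v - c *\<^sub>R w" a] \<open>a < b\<close> by (meson not_less)
    then show "v \<in> span {w}"
      by (auto simp: span_singleton)
  next
    fix v assume "v \<in> span {w}"
    then show "v \<in> eigenspace A a"
      using w(2) by (auto simp: span_singleton eigenspace_def matrix_vector_mult_scaleR)
  qed
  then have dim: "dim (eigenspace A a) = 1"
    using w(1) by (simp add: dim_eq_card_independent)
  define R where "R = (\<Sum>l\<in>eigenvalues A - {a}. replicate_mset (dim (eigenspace A l)) l)"
  have mset: "eigenvalue_mset A = add_mset a R"
    unfolding eigenvalue_mset_def R_def by (subst sum.remove[OF fin aw]) (simp add: dim)
  have in_R: "l \<in># R \<longleftrightarrow> (l \<in> eigenvalues A - {a} \<and> dim (eigenspace A l) \<noteq> 0)" for l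
    using fin by (auto simp: R_def set_mset_sum split: if_splits)
  have geR: "b \<le> l" if l: "l \<in># R" for l
  proof -
    obtain v where v: "v \<noteq> 0" "A *v v = l *\<^sub>R v" and "l \<noteq> a"
      using l by (auto simp: in_R eigenvalues_def)
    have "l * (v \<bullet> w) = a * (v \<bullet> w)"
      using inner_matrix_vector_mult_symmetric[OF sym, of v w]
      unfolding v(2) w(2) inner_scaleR_left inner_scaleR_right by (simp only:)
    then have "v \<bullet> w = 0"
      using \<open>l \<noteq> a\<close> by (metis mult_right_cancel)
    then show ?thesis
      using ge v by simp
  qed
  \<comment> \<open>Entry 1 must exist. The orthogonal complement of \<open>w\<close> is invariant
    and nonzero, so it contains a further eigenvector.\<close>
  have "{v. w \<bullet> v = 0} \<noteq> {0}"
  proof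
    assume eq: "{v. w \<bullet> v = 0} = {0}"
    have "dim {v. w \<bullet> v = 0} = CARD('n) - 1"
      using dim_hyperplane[OF w(1)] by simp
    then show False
      using card by (simp add: eq)
  qed
  moreover have "w \<bullet> (A *v x) = 0" if "w \<bullet> x = 0" for x
    using inner_matrix_vector_mult_symmetric[OF sym, of w x] that w(2) by simp
  ultimately obtain v l where v: "w \<bullet> v = 0" "v \<noteq> 0" "A *v v = l *\<^sub>R v"
    using symmetric_eigenvector_in_invariant_subspace[OF sym subspace_hyperplane[of w]]
    by auto
  then have "b \<le> l"
    using ge by (simp add: inner_commute)
  moreover have "dim (eigenspace A l) \<noteq> 0"
    using v by (auto simp: eigenspace_def)
  ultimately have "l \<in># R"
    using v \<open>a < b\<close> by (auto simp: in_R eigenvalues_def)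
  then have "R \<noteq> {#}" by auto
  then show ?thesis
    using nth_1_sorted_list_of_multiset_ge[of R b a] geR \<open>a < b\<close>
    by (simp add: spectral_gap_def mset)
qed

section \<open>The quadratic form of the distance matrix\<close>

definition dist_form :: "('a::finite \<Rightarrow> 'a \<Rightarrow> real) \<Rightarrow> ('a \<Rightarrow> real) \<Rightarrow> ('a \<Rightarrow> real) \<Rightarrow> real" where
  "dist_form d f g = (\<Sum>u\<in>UNIV. \<Sum>v\<in>UNIV. f u * g v * d u v)"

lemma dist_form_commute:
  assumes "\<And>u v. d u v = d v u"
  shows "dist_form d f g = dist_form d g f"
  unfolding dist_form_def by (subst sum.swap) (simp add: assms mult.commute)

lemma dist_form_le_twice:
  fixes d :: "'a::finite \<Rightarrow> 'a \<Rightarrow> real"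
  assumes sym: "\<And>u v. d u v = d v u"
    and tri: "\<And>u v w. d u v \<le> d u w + d w v"
    and p: "\<And>u. p u \<ge> 0" and q: "\<And>u. q u \<ge> 0"
    and sums: "sum p UNIV = sum q UNIV"
  shows "dist_form d p p \<le> 2 * dist_form d p q"
proof (cases "sum p UNIV = 0")
  case True
  then have "p u = 0" for u
    using p by (simp add: sum_nonneg_eq_0_iff)
  then show ?thesis by (simp add: dist_form_def)
next
  case False
  define s where "s = sum p UNIV"
  have s: "s > 0"
    using False p unfolding s_def by (simp add: order_less_le sum_nonneg)
  \<comment> \<open>Here \<open>s\<close> is read as the sum of \<open>p\<close> over an index
    absent from the distance.\<close>
  have expand: "s * dist_form d p q = (\<Sum>u\<in>UNIV. \<Sum>v\<in>UNIV. \<Sum>w\<in>UNIV. p u * p v * q w * d v w)"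
  proof -
    have "s * dist_form d p q = (\<Sum>u\<in>UNIV. p u * dist_form d p q)"
      by (simp add: s_def sum_distrib_right)
    then show ?thesis
      by (simp add: dist_form_def sum_distrib_left mult.assoc)
  qed
  \<comment> \<open>Now \<open>s\<close> is read as the sum of \<open>q\<close>, which introduces
    the intermediate point \<open>w\<close> with weight \<open>q w\<close>.\<close>
  have "s * dist_form d p p = (\<Sum>u\<in>UNIV. \<Sum>v\<in>UNIV. \<Sum>w\<in>UNIV. p u * p v * q w * d u v)"
    unfolding s_def sums dist_form_def
    by (simp add: sum_distrib_left sum_distrib_right mult_ac)
  also have "\<dots> \<le> (\<Sum>u\<in>UNIV. \<Sum>v\<in>UNIV. \<Sum>w\<in>UNIV. p u * p v * q w * (d u w + d w v))"
    by (intro sum_mono mult_left_mono tri mult_nonneg_nonneg p q)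
  also have "\<dots> = (\<Sum>u\<in>UNIV. \<Sum>v\<in>UNIV. \<Sum>w\<in>UNIV. p u * p v * q w * d u w)
      + (\<Sum>u\<in>UNIV. \<Sum>v\<in>UNIV. \<Sum>w\<in>UNIV. p u * p v * q w * d v w)"
    by (simp add: distrib_left sum.distrib sym)
  also have "(\<Sum>u\<in>UNIV. \<Sum>v\<in>UNIV. \<Sum>w\<in>UNIV. p u * p v * q w * d v w)
      = s * dist_form d p q"
    by (rule expand[symmetric])
  also have "(\<Sum>u\<in>UNIV. \<Sum>v\<in>UNIV. \<Sum>w\<in>UNIV. p u * p v * q w * d u w)
      = (\<Sum>v\<in>UNIV. \<Sum>u\<in>UNIV. \<Sum>w\<in>UNIV. p u * p v * q w * d u w)"
    by (rule sum.swap)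
  also have "\<dots> = s * dist_form d p q"
    unfolding expand by (simp add: mult_ac)
  finally have "s * dist_form d p p \<le> s * (2 * dist_form d p q)" by simp
  then show ?thesis
    using s by simp
qed

text \<open>AM-GM on each product splits the form into two halves, equal by symmetry of
  \<open>d\<close>; summing out the free index produces the transmission.\<close>

lemma dist_form_abs_le_transmission:
  fixes d :: "'a::finite \<Rightarrow> 'a \<Rightarrow> real"
  assumes sym: "\<And>u v. d u v = d v u" and nonneg: "\<And>u v. 0 \<le> d u v"
  shows "dist_form d (\<lambda>u. \<bar>f u\<bar>) (\<lambda>u. \<bar>f u\<bar>) \<le> (\<Sum>u\<in>UNIV. transmission d u * (f u)^2)"
proof -
  have amgm: "\<bar>x\<bar> * \<bar>y\<bar> \<le> (x^2 + y^2) / 2" for x y :: real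
    using sum_squares_bound[of "\<bar>x\<bar>" "\<bar>y\<bar>"] by simp
  have "dist_form d (\<lambda>u. \<bar>f u\<bar>) (\<lambda>u. \<bar>f u\<bar>)
      \<le> (\<Sum>u\<in>UNIV. \<Sum>v\<in>UNIV. ((f u)^2 + (f v)^2) / 2 * d u v)"
    unfolding dist_form_def by (intro sum_mono mult_right_mono amgm nonneg)
  also have "\<dots> = ((\<Sum>u\<in>UNIV. \<Sum>v\<in>UNIV. (f u)^2 * d u v)
      + (\<Sum>u\<in>UNIV. \<Sum>v\<in>UNIV. (f v)^2 * d u v)) / 2"
    by (simp add: sum.distrib add_divide_distrib distrib_right sum_divide_distrib)
  also have "(\<Sum>u\<in>UNIV. \<Sum>v\<in>UNIV. (f v)^2 * d u v) = (\<Sum>u\<in>UNIV. \<Sum>v\<in>UNIV. (f u)^2 * d u v)"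
    by (subst sum.swap) (simp add: sym)
  finally show ?thesis
    by (simp add: transmission_def sum_distrib_right mult.commute)
qed

lemma dist_form_le_third_transmission:
  fixes d :: "'a::finite \<Rightarrow> 'a \<Rightarrow> real"
  assumes sym: "\<And>u v. d u v = d v u" and nonneg: "\<And>u v. 0 \<le> d u v"
    and tri: "\<And>u v w. d u v \<le> d u w + d w v"
    and f: "sum f UNIV = 0"
  shows "3 * dist_form d f f \<le> (\<Sum>u\<in>UNIV. transmission d u * (f u)^2)"
proof -
  define p where "p u = max (f u) 0" for u
  define q where "q u = max (- f u) 0" for u
  have p0: "p u \<ge> 0" and q0: "q u \<ge> 0" and fpq: "f u = p u - q u"
    and apq: "\<bar>f u\<bar> = p u + q u" for u
    by (auto simp: p_def q_def)
  have sums: "sum p UNIV = sum q UNIV"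
    using f by (simp add: fpq sum_subtractf)
  have qp: "dist_form d q p = dist_form d p q"
    by (rule dist_form_commute[OF sym])
  have "dist_form d f f = dist_form d p p - dist_form d p q - dist_form d q p + dist_form d q q"
    unfolding dist_form_def fpq by (simp add: algebra_simps sum.distrib sum_subtractf)
  moreover have "dist_form d (\<lambda>u. \<bar>f u\<bar>) (\<lambda>u. \<bar>f u\<bar>)
      = dist_form d p p + dist_form d p q + dist_form d q p + dist_form d q q"
    unfolding dist_form_def apq by (simp add: algebra_simps sum.distrib)
  moreover have "dist_form d p p \<le> 2 * dist_form d p q"
    by (rule dist_form_le_twice[OF sym tri p0 q0 sums])
  moreover have "dist_form d q q \<le> 2 * dist_form d q p"
    by (rule dist_form_le_twice[OF sym tri q0 p0 sums[symmetric]])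
  moreover have "dist_form d (\<lambda>u. \<bar>f u\<bar>) (\<lambda>u. \<bar>f u\<bar>) \<le> (\<Sum>u\<in>UNIV. transmission d u * (f u)^2)"
    by (rule dist_form_abs_le_transmission[OF sym nonneg])
  \<comment> \<open>With P, Q, M the forms at \<open>(p, p)\<close>, \<open>(q, q)\<close>,
    \<open>(p, q)\<close>, the inequality 3(P + Q - 2M) \<le> P + Q + 2M amounts to P + Q \<le>
    4M.\<close>
  ultimately show ?thesis
    using qp by linarith
qed

section \<open>The normalized distance Laplacian\<close>

lemma normalized_distance_laplacian_nth:
  "normalized_distance_laplacian d $ u $ v =
     transmission d u powr (-1/2) * ((if u = v then transmission d u else 0) - d u v)
       * transmission d v powr (-1/2)"
  unfolding normalized_distance_laplacian_def transmission_matrix_def diag_matrix_def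
    distance_matrix_def matrix_matrix_mult_def
  by (simp add: if_distribR if_distrib[of "\<lambda>x. x * _"] if_distrib[of "\<lambda>x. _ * x"] cong: if_cong)

lemma transpose_normalized_distance_laplacian:
  assumes "\<And>u v. d u v = d v u"
  shows "transpose (normalized_distance_laplacian d) = normalized_distance_laplacian d"
  using assms by (simp add: vec_eq_iff transpose_def normalized_distance_laplacian_nth)

lemma transmission_pos:
  fixes d :: "'a::finite \<Rightarrow> 'a \<Rightarrow> real"
  assumes "Metric_space (UNIV :: 'a set) d" "CARD('a) \<ge> 2"
  shows "transmission d u > 0"
proof -
  interpret Metric_space "UNIV :: 'a set" d by fact
  have "(UNIV :: 'a set) \<noteq> {u}"
    using assms(2) by (intro notI) (drule arg_cong[of _ _ card], simp)
  then obtain v where v: "v \<noteq> u" by auto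
  then have "0 < d u v"
    using nonneg[of u v] zero[of u v] by simp
  then show ?thesis
    unfolding transmission_def by (intro sum_pos2[of _ v]) auto
qed

text \<open>Substituting \<open>T\<^sup>1\<^sup>/\<^sup>2 f\<close> cancels the right outer factor,
  so only \<open>T\<^sup>-\<^sup>1\<^sup>/\<^sup>2 (T - D) f\<close> remains.\<close>

lemma normalized_distance_laplacian_mult_sqrt:
  assumes "\<And>u. transmission d u > 0"
  shows "(normalized_distance_laplacian d *v (\<chi> u. sqrt (transmission d u) * f u)) $ u
    = (transmission d u * f u - (\<Sum>v\<in>UNIV. d u v * f v)) / sqrt (transmission d u)"
proof -
  have pw: "transmission d v powr (-1/2) = 1 / sqrt (transmission d v)" for v
    using assms[of v] by (simp add: powr_half_sqrt[symmetric] powr_minus_divide)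
  have cancel: "1 / r * x * (1 / sqrt (transmission d v)) * (sqrt (transmission d v) * y) = x * y / r"
    for r x y v using assms[of v] by simp
  have "(normalized_distance_laplacian d *v (\<chi> u. sqrt (transmission d u) * f u)) $ u
      = (\<Sum>v\<in>UNIV. ((if u = v then transmission d u else 0) - d u v) * f v
          / sqrt (transmission d u))"
    by (simp only: matrix_vector_mult_def normalized_distance_laplacian_nth pw cancel vec_lambda_beta)
  also have "\<dots> = (\<Sum>v\<in>UNIV. ((if u = v then transmission d u * f v else 0) - d u v * f v)
          / sqrt (transmission d u))"
    by (rule sum.cong) (auto simp: left_diff_distrib)
  finally show ?thesis
    by (simp add: sum_divide_distrib[symmetric] sum_subtractf)
qed

lemma inner_normalized_distance_laplacian_sqrt:
  assumes "\<And>u. transmission d u > 0"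
  shows "(\<chi> u. sqrt (transmission d u) * f u)
      \<bullet> (normalized_distance_laplacian d *v (\<chi> u. sqrt (transmission d u) * f u))
    = (\<Sum>u\<in>UNIV. transmission d u * (f u)^2) - dist_form d f f"
proof -
  have "(\<chi> u. sqrt (transmission d u) * f u)
      \<bullet> (normalized_distance_laplacian d *v (\<chi> u. sqrt (transmission d u) * f u))
    = (\<Sum>u\<in>UNIV. f u * (transmission d u * f u - (\<Sum>v\<in>UNIV. d u v * f v)))"
    unfolding inner_vec_def normalized_distance_laplacian_mult_sqrt[OF assms]
    using assms by (simp add: less_imp_neq[symmetric])
  then show ?thesis
    by (simp add: dist_form_def right_diff_distrib sum_subtractf power2_eq_square
        sum_distrib_left mult_ac)
qed

theorem theorem5p1:
  fixes d :: "'a::finite \<Rightarrow> 'a \<Rightarrow> real"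
  assumes "Metric_space (UNIV :: 'a set) d"
    and "CARD('a) \<ge> 2"
  shows "spectral_gap (normalized_distance_laplacian d) \<ge> (9 - 4 * sqrt 2) / 7"
proof -
  interpret Metric_space "UNIV :: 'a set" d by fact
  have d_sym: "d u v = d v u" and d_nonneg: "0 \<le> d u v" and d_tri: "d u v \<le> d u w + d w v"
    for u v w
    using commute nonneg triangle[of u w v] by auto
  have pos: "transmission d u > 0" for u
    by (rule transmission_pos[OF assms])
  let ?L = "normalized_distance_laplacian d"
  have sym: "transpose ?L = ?L"
    by (rule transpose_normalized_distance_laplacian[OF d_sym])
  define lift :: "('a \<Rightarrow> real) \<Rightarrow> real ^ 'a"
    where "lift f = (\<chi> u. sqrt (transmission d u) * f u)" for f
  define w where "w = lift (\<lambda>_. 1)"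
  have "w $ u \<noteq> 0" for u
    using pos[of u] by (simp add: w_def lift_def)
  then have w0: "w \<noteq> 0" by (metis zero_index)
  \<comment> \<open>The rows of \<open>T - D\<close> sum to zero.\<close>
  have Lw: "?L *v w = 0"
    unfolding w_def lift_def vec_eq_iff normalized_distance_laplacian_mult_sqrt[OF pos]
    by (simp add: transmission_def)
  have form_ge: "2/3 * (y \<bullet> y) \<le> y \<bullet> (?L *v y)"
    if y: "y = lift f" and f: "sum f UNIV = 0" for y f
  proof -
    have "y \<bullet> y = (\<Sum>u\<in>UNIV. transmission d u * (f u)^2)"
      using pos by (simp add: y lift_def inner_vec_def power_mult_distrib less_imp_le
          flip: power2_eq_square)
    moreover have "y \<bullet> (?L *v y) = (\<Sum>u\<in>UNIV. transmission d u * (f u)^2) - dist_form d f f"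
      unfolding y lift_def by (rule inner_normalized_distance_laplacian_sqrt[OF pos])
    ultimately show ?thesis
      using dist_form_le_third_transmission[where d = d, OF d_sym d_nonneg d_tri f] by simp
  qed
  have "2/3 \<le> l" if v: "v \<noteq> 0" "v \<bullet> w = 0" "?L *v v = l *\<^sub>R v" for v l
  proof -
    define g where "g u = v $ u / sqrt (transmission d u)" for u
    \<comment> \<open>The mean of \<open>g\<close>, where \<open>v = lift g\<close>. Subtracting
      \<open>c *\<^sub>R w\<close> moves \<open>v\<close> into the hyperplane of lifts with
      coordinate sum zero, where \<open>form_ge\<close> applies.\<close>
    define c where "c = sum g UNIV / real CARD('a)"
    define y where "y = v - c *\<^sub>R w"
    have "y = lift (\<lambda>u. g u - c)"
      using pos by (simp add: y_def w_def lift_def g_def vec_eq_iff algebra_simps less_imp_neq[symmetric])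
    moreover have "(\<Sum>u\<in>UNIV. g u - c) = 0"
      by (simp add: sum_subtractf c_def)
    ultimately have "2/3 * (y \<bullet> y) \<le> y \<bullet> (?L *v y)"
      by (rule form_ge)
    \<comment> \<open>The shift by a kernel vector orthogonal to \<open>v\<close> leaves the
      quadratic form unchanged.\<close>
    also have "y \<bullet> (?L *v y) = l * (v \<bullet> v)"
      using v Lw by (simp add: y_def matrix_vector_mult_diff_distrib matrix_vector_mult_scaleR
          inner_diff_left inner_diff_right inner_commute)
    finally have "2/3 * (y \<bullet> y) \<le> l * (v \<bullet> v)" .
    \<comment> \<open>By Pythagoras the shift can only lengthen \<open>v\<close>, so the lower bound
      survives the return from \<open>y\<close> to \<open>v\<close>.\<close>
    moreover have "y \<bullet> y = v \<bullet> v + c^2 * (w \<bullet> w)"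
      using v by (simp add: y_def inner_diff_left inner_diff_right inner_commute power2_eq_square)
    moreover have "0 \<le> c^2 * (w \<bullet> w)" by simp
    ultimately have "2/3 * (v \<bullet> v) \<le> l * (v \<bullet> v)" by linarith
    then show ?thesis
      using v(1) by simp
  qed
  then have "spectral_gap ?L \<ge> 2/3"
    using spectral_gap_ge[OF sym assms(2) w0, of 0 "2/3"] Lw by simp
  moreover have "(9 - 4 * sqrt 2) / 7 \<le> 2/(3::real)"
  proof -
    \<comment> \<open>Clearing denominators turns the comparison with 2/3 into exactly this
      bound.\<close>
    have "13/12 \<le> sqrt 2" by (rule real_le_rsqrt) (simp add: power2_eq_square)
    then show ?thesis by simp
  qed
  ultimately show ?thesis by linarith
qed

end
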